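(* In the setting described in the context, if the instance of SUP' admits a feasible solution of makespan at most $T$, then the mixed-integer linear program (MILP) described in the context has a feasible solution.
   Context: Let $\varepsilon>0$ be rational with $1/\varepsilon\in\mathbb{Z}$. An instance consists of a set $\mathcal{J}$ of $n$ jobs with sizes $p_j\ge 0$, $m$ identical machines, a positive integer $k$ and a rational $U\ge 0$. Let $T>0$ be a value with $T\ge\max_j p_j$. A job is small if $p_j<\varepsilon T$ and large otherwise; $\mathcal{S}$ and $\mathcal{L}$ denote the sets of small and large jobs, $\Lambda$ the set of distinct sizes of large jobs, and $\mathcal{L}_\ell$ the set of large jobs of size $\ell$. For every job let $\tilde p_j=p_j+U/k$ (modified size). Problem SUP': a feasible solution is a partition of $\mathcal{J}$ into $m$ subsets (one per machine). For a machine with job set $\sigma_i$, sort $\sigma_i$ in non-increasing order of size (ties broken arbitrarily); the early jobs $E_i$ are the first $k/\varepsilon$ jobs in this order (all jobs if $|\sigma_i|\le k/\varepsilon$) and the late jobs $\mathcal{L}^{\mathrm{late}}_i$ are the remaining ones. The load of machine $i$ is $\sum_{j\in E_i}p_j+\left\lfloor\frac{|E_i|-1}{k}\right\rfloor U$ if $|\sigma_i|\le k/\varepsilon$, and $\sum_{j\in E_i}p_j+\sum_{j\in \mathcal{L}^{\mathrm{late}}_i}\tilde p_j+U/\varepsilon$ if $|\sigma_i|>k/\varepsilon$. The makespan is the maximum load. Configurations: a configuration $c$ is a vector consisting of nonnegative integers $\alpha_{c\ell}$ ($\ell\in\Lambda$), a nonnegative integer $\beta_c$, a nonnegative integer $\gamma_c$,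 a bit $\gamma'_c\in\{0,1\}$ (with $\gamma_c=0$ whenever $\gamma'_c=0$), and an integer $\delta_c\in\{0,1,\dots,1/\varepsilon\}$. (Intended meaning: $\alpha_{c\ell}$ = number of large jobs of size $\ell$; total size of small early jobs lies in $[\beta_c\varepsilon T,(\beta_c+1)\varepsilon T)$; total modified size of late jobs lies in $[\gamma_c\varepsilon T,(\gamma_c+1)\varepsilon T)$; $\gamma'_c=1$ iff there is a late job; the number of early jobs lies in $[(\delta_c-1)k+1,\delta_c k]$.) Its load is $L_c=\sum_{\ell\in\Lambda}\ell\,\alpha_{c\ell}+\beta_c\varepsilon T+\gamma'_c\gamma_c\varepsilon T+U(\delta_c-1+\gamma'_c)$, and $c$ is feasible if $L_c\le T$. Let $\mathcal{C}$ be the set of feasible configurations. The MILP has integer variables $x_c\in\mathbb{Z}_{\ge0}$ ($c\in\mathcal{C}$) and real variables $y_{jc},z_{jc}\in[0,1]$ ($j\in\mathcal{S}$, $c\in\mathcal{C}$), and constraints: $\sum_{c\in\mathcal{C}}x_c=m$; $\sum_{c\in\mathcal{C}}(y_{jc}+z_{jc})=1$ for all $j\in\mathcal{S}$; $\sum_{j\in\mathcal{S}}y_{jc}p_j\le x_c(\beta_c+1)\varepsilon T$ for all $c$; $\sum_{j\in\mathcal{S}}z_{jc}\tilde p_j\le x_c\gamma'_c(\gamma_c+1)\varepsilon T$ for all $c$; $\sum_{c\in\mathcal{C}}\alpha_{c\ell}x_c=|\mathcal{L}_\ell|$ for all $\ell\in\Lambda$; $\sum_{\ell\in\Lambda}\alpha_{c\ell}x_c+\sum_{j\in\mathcal{S}}y_{jc}\le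 x_c\delta_c k$ for all $c$. *)

theory Defs
  imports Complex_Main "HOL-Library.Disjoint_Sets"
begin

definition small_jobs :: "'j set \<Rightarrow> ('j \<Rightarrow> real) \<Rightarrow> real \<Rightarrow> real \<Rightarrow> 'j set" where
  "small_jobs J p \<epsilon> T = {j \<in> J. p j < \<epsilon> * T}"

definition large_jobs :: "'j set \<Rightarrow> ('j \<Rightarrow> real) \<Rightarrow> real \<Rightarrow> real \<Rightarrow> 'j set" where
  "large_jobs J p \<epsilon> T = {j \<in> J. \<not> p j < \<epsilon> * T}"

definition large_sizes :: "'j set \<Rightarrow> ('j \<Rightarrow> real) \<Rightarrow> real \<Rightarrow> real \<Rightarrow> real set" where
  "large_sizes J p \<epsilon> T = p ` large_jobs J p \<epsilon> T"

definition large_jobs_of_size :: "'j set \<Rightarrow> ('j \<Rightarrow> real) \<Rightarrow> real \<Rightarrow> real \<Rightarrow> real \<Rightarrow> 'j set" where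
  "large_jobs_of_size J p \<epsilon> T l = {j \<in> large_jobs J p \<epsilon> T. p j = l}"

definition modified_size :: "('j \<Rightarrow> real) \<Rightarrow> nat \<Rightarrow> real \<Rightarrow> 'j \<Rightarrow> real" where
  "modified_size p k U j = p j + U / real k"

(* Machines are the indices below m. A machine may receive no job, so this is an
   indexed partition with possibly empty parts. *)
definition sup_solution :: "'j set \<Rightarrow> nat \<Rightarrow> (nat \<Rightarrow> 'j set) \<Rightarrow> bool" where
  "sup_solution J m \<sigma> \<longleftrightarrow> disjoint_family_on \<sigma> {..<m} \<and> (\<Union>i<m. \<sigma> i) = J"

(* A list is used because equal sizes may be ordered in any way. *)
definition size_ordering :: "('j \<Rightarrow> real) \<Rightarrow> 'j set \<Rightarrow> 'j list \<Rightarrow> bool" where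
  "size_ordering p S xs \<longleftrightarrow> distinct xs \<and> set xs = S \<and> sorted_wrt (\<lambda>i j. p i \<ge> p j) xs"

(* The floor is exact whenever 1 / \<epsilon> is an integer. *)
definition early_jobs :: "nat \<Rightarrow> real \<Rightarrow> 'j list \<Rightarrow> 'j set" where
  "early_jobs k \<epsilon> xs = set (take (nat \<lfloor>real k / \<epsilon>\<rfloor>) xs)"

definition late_jobs :: "nat \<Rightarrow> real \<Rightarrow> 'j list \<Rightarrow> 'j set" where
  "late_jobs k \<epsilon> xs = set (drop (nat \<lfloor>real k / \<epsilon>\<rfloor>) xs)"

definition machine_load :: "('j \<Rightarrow> real) \<Rightarrow> nat \<Rightarrow> real \<Rightarrow> real \<Rightarrow> 'j list \<Rightarrow> real" where
  "machine_load p k U \<epsilon> xs =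
    (if real (card (set xs)) \<le> real k / \<epsilon>
     then (\<Sum>j\<in>early_jobs k \<epsilon> xs. p j)
          + of_int \<lfloor>(real (card (early_jobs k \<epsilon> xs)) - 1) / real k\<rfloor> * U
     else (\<Sum>j\<in>early_jobs k \<epsilon> xs. p j)
          + (\<Sum>j\<in>late_jobs k \<epsilon> xs. modified_size p k U j) + U / \<epsilon>)"

definition makespan :: "('j \<Rightarrow> real) \<Rightarrow> nat \<Rightarrow> nat \<Rightarrow> real \<Rightarrow> real \<Rightarrow> (nat \<Rightarrow> 'j list) \<Rightarrow> real" where
  "makespan p m k U \<epsilon> ord = Max ((\<lambda>i. machine_load p k U \<epsilon> (ord i)) ` {..<m})"

datatype config =
  Config (alpha: "real \<Rightarrow> nat") (beta: nat) (gamma: nat) (gamma_bit: nat) (delta: nat)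

(* The vector alpha is indexed by the large sizes only; it is represented by a
   function on all reals that vanishes elsewhere. *)
definition is_config :: "real set \<Rightarrow> real \<Rightarrow> config \<Rightarrow> bool" where
  "is_config \<Lambda> \<epsilon> c \<longleftrightarrow>
     (\<forall>l. l \<notin> \<Lambda> \<longrightarrow> alpha c l = 0) \<and>
     gamma_bit c \<in> {0, 1} \<and>
     (gamma_bit c = 0 \<longrightarrow> gamma c = 0) \<and>
     real (delta c) \<le> 1 / \<epsilon>"

definition config_load :: "real set \<Rightarrow> real \<Rightarrow> real \<Rightarrow> real \<Rightarrow> config \<Rightarrow> real" where
  "config_load \<Lambda> U \<epsilon> T c =
     (\<Sum>l\<in>\<Lambda>. l * real (alpha c l)) + real (beta c) * \<epsilon> * T
     + real (gamma_bit c) * real (gamma c) * \<epsilon> * T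
     + U * (real (delta c) - 1 + real (gamma_bit c))"

definition feasible_configs :: "real set \<Rightarrow> real \<Rightarrow> real \<Rightarrow> real \<Rightarrow> config set" where
  "feasible_configs \<Lambda> U \<epsilon> T = {c. is_config \<Lambda> \<epsilon> c \<and> config_load \<Lambda> U \<epsilon> T c \<le> T}"

definition milp_solution ::
  "'j set \<Rightarrow> ('j \<Rightarrow> real) \<Rightarrow> nat \<Rightarrow> nat \<Rightarrow> real \<Rightarrow> real \<Rightarrow> real \<Rightarrow>
   (config \<Rightarrow> nat) \<Rightarrow> ('j \<Rightarrow> config \<Rightarrow> real) \<Rightarrow> ('j \<Rightarrow> config \<Rightarrow> real) \<Rightarrow> bool" where
  "milp_solution J p m k U \<epsilon> T x y z \<longleftrightarrow>
    (let S = small_jobs J p \<epsilon> T;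
         \<Lambda> = large_sizes J p \<epsilon> T;
         C = feasible_configs \<Lambda> U \<epsilon> T
     in (\<forall>j\<in>S. \<forall>c\<in>C. y j c \<in> {0..1} \<and> z j c \<in> {0..1}) \<and>
        (\<Sum>c\<in>C. x c) = m \<and>
        (\<forall>j\<in>S. (\<Sum>c\<in>C. y j c + z j c) = 1) \<and>
        (\<forall>c\<in>C. (\<Sum>j\<in>S. y j c * p j) \<le> real (x c) * (real (beta c) + 1) * \<epsilon> * T) \<and>
        (\<forall>c\<in>C. (\<Sum>j\<in>S. z j c * modified_size p k U j)
                  \<le> real (x c) * real (gamma_bit c) * (real (gamma c) + 1) * \<epsilon> * T) \<and>
        (\<forall>l\<in>\<Lambda>. (\<Sum>c\<in>C. alpha c l * x c) = card (large_jobs_of_size J p \<epsilon> T l)) \<and>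
        (\<forall>c\<in>C. (\<Sum>l\<in>\<Lambda>. real (alpha c l) * real (x c)) + (\<Sum>j\<in>S. y j c)
                  \<le> real (x c) * real (delta c) * real k))"

(* The sums over configurations in the program are genuine finite sums. *)
lemma finite_feasible_configs:
  assumes "finite J" "\<epsilon> > 0" "T > 0" "U \<ge> 0"
  shows "finite (feasible_configs (large_sizes J p \<epsilon> T) U \<epsilon> T)"
proof -
  define \<Lambda> where "\<Lambda> = large_sizes J p \<epsilon> T"
  define e where "e = \<epsilon> * T"
  have e: "e > 0" using assms by (simp add: e_def)
  have fin: "finite \<Lambda>"
    using assms(1) by (simp add: \<Lambda>_def large_sizes_def large_jobs_def)
  have ge: "l \<ge> e" if "l \<in> \<Lambda>" for l
    using that by (auto simp: \<Lambda>_def large_sizes_def large_jobs_def e_def)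
  define N where "N = nat \<lceil>(T + U) / e\<rceil>"
  define D where "D = nat \<lceil>1 / \<epsilon>\<rceil>"
  define F where "F = {f :: real \<Rightarrow> nat. \<forall>l. (l \<in> \<Lambda> \<longrightarrow> f l \<in> {..N}) \<and> (l \<notin> \<Lambda> \<longrightarrow> f l = 0)}"
  have finF: "finite F"
    unfolding F_def by (rule finite_set_of_finite_funs) (use fin in auto)
  have N: "a \<le> N" if "real a * e \<le> T + U" for a
  proof -
    have "real a \<le> (T + U) / e" using that e by (simp add: pos_le_divide_eq)
    then show ?thesis unfolding N_def by linarith
  qed
  have "feasible_configs \<Lambda> U \<epsilon> T \<subseteq>
      (\<lambda>(a, b, g, g', d). Config a b g g' d) ` (F \<times> {..N} \<times> {..N} \<times> {0, 1} \<times> {..D})"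
  proof
    fix c assume c: "c \<in> feasible_configs \<Lambda> U \<epsilon> T"
    then have cfg: "is_config \<Lambda> \<epsilon> c" and load: "config_load \<Lambda> U \<epsilon> T c \<le> T"
      by (auto simp: feasible_configs_def)
    define A where "A = (\<Sum>l\<in>\<Lambda>. l * real (alpha c l))"
    have nonneg: "0 \<le> l * real (alpha c l)" if "l \<in> \<Lambda>" for l
      using ge[OF that] e by simp
    have A0: "A \<ge> 0" unfolding A_def by (rule sum_nonneg) (rule nonneg)
    have "U * (real (delta c) - 1 + real (gamma_bit c)) \<ge> U * (- 1)"
      using assms(4) by (intro mult_left_mono) auto
    then have sum: "A + real (beta c) * e + real (gamma_bit c) * real (gamma c) * e \<le> T + U"
      using load by (simp add: config_load_def A_def e_def mult.assoc)
    have nn: "0 \<le> real (beta c) * e" "0 \<le> real (gamma_bit c) * real (gamma c) * e"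
      using e by simp_all
    have "beta c \<le> N" using sum A0 nn by (intro N) linarith
    moreover have "real (gamma c) * e = real (gamma_bit c) * real (gamma c) * e"
      using cfg by (auto simp: is_config_def)
    then have "gamma c \<le> N" using sum A0 nn by (intro N) linarith
    moreover have "alpha c \<in> F"
    proof -
      have "alpha c l \<le> N" if l: "l \<in> \<Lambda>" for l
      proof (rule N)
        have "real (alpha c l) * e \<le> l * real (alpha c l)"
          using mult_right_mono[OF ge[OF l], of "real (alpha c l)"] by (simp add: mult.commute)
        also have "\<dots> \<le> A"
          unfolding A_def by (rule member_le_sum[OF l]) (use nonneg fin in auto)
        finally show "real (alpha c l) * e \<le> T + U" using sum nn by linarith
      qed
      then show ?thesis using cfg by (auto simp: F_def is_config_def)
    qed
    moreover have "delta c \<le> D"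
    proof -
      have "real (delta c) \<le> 1 / \<epsilon>" using cfg by (simp add: is_config_def)
      then show ?thesis unfolding D_def by linarith
    qed
    moreover have "gamma_bit c \<in> {0, 1}" using cfg by (simp add: is_config_def)
    ultimately show "c \<in> (\<lambda>(a, b, g, g', d). Config a b g g' d) `
        (F \<times> {..N} \<times> {..N} \<times> {0, 1} \<times> {..D})"
      by (intro image_eqI[of _ _ "(alpha c, beta c, gamma c, gamma_bit c, delta c)"]) auto
  qed
  then have "finite (feasible_configs \<Lambda> U \<epsilon> T)"
    by (rule finite_subset) (use finF in auto)
  then show ?thesis by (simp add: \<Lambda>_def)
qed

end

theory Submission
  imports Defs
begin

text \<open>
  Each machine of a feasible solution is rounded to a configuration, \<open>x\<close> counts the machines
  per configuration, and \<open>y\<close>, \<open>z\<close> are the 0/1 indicators of a small job being early or late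
  on a machine of a given configuration; every constraint is then a sum over machines of a
  single-machine inequality. The only real point is that a configuration has no room for late
  large jobs: if some late job were large, then so would be the \<open>k/\<epsilon>\<close> early jobs, whose total
  size \<open>(k/\<epsilon>) \<epsilon> T \<ge> T\<close> already exhausts the makespan.
\<close>

section \<open>Large jobs are never late\<close>

lemma late_jobs_small:
  fixes p :: "'j \<Rightarrow> real" and T \<epsilon> U :: real and k :: nat
  assumes eps: "\<epsilon> > 0" "1 / \<epsilon> \<in> \<int>" and k: "k > 0" and U: "U \<ge> 0" and T: "T > 0"
    and ord: "size_ordering p A xs" and nonneg: "\<forall>j\<in>A. p j \<ge> 0"
    and load: "machine_load p k U \<epsilon> xs \<le> T" and j: "j \<in> late_jobs k \<epsilon> xs"
  shows "p j < \<epsilon> * T"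
proof (rule ccontr)
  assume "\<not> p j < \<epsilon> * T"
  then have large: "p j \<ge> \<epsilon> * T" by simp
  define K where "K = nat \<lfloor>real k / \<epsilon>\<rfloor>"
  define E where "E = set (take K xs)"
  define D where "D = set (drop K xs)"
  have xs: "distinct xs" "set xs = A" and sorted: "sorted_wrt (\<lambda>i j. p i \<ge> p j) xs"
    using ord by (auto simp: size_ordering_def)
  \<comment> \<open>Integrality of \<open>1 / \<epsilon>\<close> makes the floor in \<open>K\<close>
    exact, so that \<open>K\<close> jobs of size at least \<open>\<epsilon> * T\<close> add up to at
    least \<open>k * T\<close> with no rounding loss.\<close>
  have "real k * (1 / \<epsilon>) \<in> \<int>" using eps(2) by (intro Ints_mult) auto
  then have K: "real K = real k / \<epsilon>"
    using eps(1) by (auto simp: K_def elim!: Ints_cases)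
  have jD: "j \<in> D" using j by (simp add: D_def K_def late_jobs_def)
  then have len: "K < length xs"
    by (metis D_def drop_all empty_iff list.set(1) not_le)
  have cardE: "card E = K"
    using xs(1) len by (simp add: E_def distinct_card)
  \<comment> \<open>Splitting the sorted list at \<open>K\<close> shows that every early job is at
    least as large as the late job \<open>j\<close>.\<close>
  have "sorted_wrt (\<lambda>i j. p i \<ge> p j) (take K xs @ drop K xs)" using sorted by simp
  then have "p i \<ge> \<epsilon> * T" if "i \<in> E" for i
    using that jD large unfolding sorted_wrt_append E_def D_def by fastforce
  then have "real (card E) * (\<epsilon> * T) \<le> sum p E"
    using sum_bounded_below[of E "\<epsilon> * T" p] by simp
  moreover have "real (card E) * (\<epsilon> * T) = real k * T" using eps(1) by (simp add: cardE K)
  moreover have "real k * T \<ge> T" using k T by simp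
  ultimately have E: "sum p E \<ge> T" by linarith
  have "p i \<ge> 0" if "i \<in> D" for i
    using nonneg xs(2) that by (auto simp: D_def dest: in_set_dropD)
  then have nn: "modified_size p k U i \<ge> 0" if "i \<in> D" for i
    using that U by (simp add: modified_size_def)
  \<comment> \<open>The bound \<open>sum p E \<ge> T\<close> alone does not contradict a load of at
    most \<open>T\<close>. The strict excess comes from \<open>j\<close> itself, whose size is
    positive because it is large.\<close>
  have "p j > 0" using large eps(1) T by (meson less_le_trans mult_pos_pos)
  then have "0 < modified_size p k U j" using U by (simp add: modified_size_def add_pos_nonneg)
  also have "\<dots> \<le> sum (modified_size p k U) D"
    by (rule member_le_sum[OF jD]) (use nn in \<open>auto simp: D_def\<close>)
  finally have D: "sum (modified_size p k U) D > 0" .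
  have "machine_load p k U \<epsilon> xs = sum p E + sum (modified_size p k U) D + U / \<epsilon>"
    using len xs(1) K by (simp add: machine_load_def early_jobs_def late_jobs_def K_def[symmetric]
        E_def D_def distinct_card flip: K)
  moreover have "U / \<epsilon> \<ge> 0" using U eps(1) by simp
  ultimately show False using E D load by linarith
qed

section \<open>Counting by size and rounding down\<close>

text \<open>For the large jobs of a machine, these identities turn the \<open>alpha\<close> terms of
  a configuration into the exact total size and number of those jobs.\<close>

lemma sum_fibre_sizes:
  fixes p :: "'j \<Rightarrow> real"
  assumes "finite A" "finite \<Lambda>" "p ` A \<subseteq> \<Lambda>"
  shows "(\<Sum>l\<in>\<Lambda>. l * real (card {j \<in> A. p j = l})) = sum p A"
    and "(\<Sum>l\<in>\<Lambda>. card {j \<in> A. p j = l}) = card A"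
proof -
  have "(\<Sum>l\<in>\<Lambda>. l * real (card {j \<in> A. p j = l})) = (\<Sum>l\<in>\<Lambda>. \<Sum>j | j \<in> A \<and> p j = l. p j)"
    by (intro sum.cong) auto
  also have "\<dots> = sum p A" by (rule sum.group[OF assms])
  finally show "(\<Sum>l\<in>\<Lambda>. l * real (card {j \<in> A. p j = l})) = sum p A" .
  show "(\<Sum>l\<in>\<Lambda>. card {j \<in> A. p j = l}) = card A"
    using sum.group[OF assms, of "\<lambda>_. 1 :: nat"] by simp
qed

text \<open>The first bound keeps the load of the rounded configuration below the true load; the
  second is the reason for the \<open>+ 1\<close> in the size constraints of the MILP.\<close>

lemma floor_nat_div_bounds:
  fixes s e :: real
  assumes "s \<ge> 0" "e > 0"
  shows "real (nat \<lfloor>s / e\<rfloor>) * e \<le> s" and "s \<le> (real (nat \<lfloor>s / e\<rfloor>) + 1) * e"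
proof -
  have n: "real (nat \<lfloor>s / e\<rfloor>) = of_int \<lfloor>s / e\<rfloor>" using assms by simp
  show "real (nat \<lfloor>s / e\<rfloor>) * e \<le> s"
    unfolding n using assms(2) by (simp flip: pos_le_divide_eq)
  show "s \<le> (real (nat \<lfloor>s / e\<rfloor>) + 1) * e"
    unfolding n using assms(2) by (simp flip: pos_divide_le_eq)
qed

section \<open>Rounding one machine to a configuration\<close>

text \<open>These are the MILP constraints for a single machine, with \<open>x c = 1\<close> and 0/1
  values for \<open>y\<close> and \<open>z\<close>. The condition on \<open>alpha\<close> is an
  exact count because its MILP constraint is an equation; the others only have to add up as
  inequalities.\<close>

definition machine_fits ::
  "'j set \<Rightarrow> ('j \<Rightarrow> real) \<Rightarrow> nat \<Rightarrow> real \<Rightarrow> real \<Rightarrow> real \<Rightarrow> 'j list \<Rightarrow> config \<Rightarrow> bool" where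
  "machine_fits J p k U \<epsilon> T xs c \<longleftrightarrow>
    c \<in> feasible_configs (large_sizes J p \<epsilon> T) U \<epsilon> T \<and>
    (\<forall>l. alpha c l = card {j \<in> set xs. \<not> p j < \<epsilon> * T \<and> p j = l}) \<and>
    (\<Sum>j\<in>small_jobs J p \<epsilon> T \<inter> early_jobs k \<epsilon> xs. p j) \<le> (real (beta c) + 1) * \<epsilon> * T \<and>
    (\<Sum>j\<in>small_jobs J p \<epsilon> T \<inter> late_jobs k \<epsilon> xs. modified_size p k U j)
      \<le> real (gamma_bit c) * (real (gamma c) + 1) * \<epsilon> * T \<and>
    (\<Sum>l\<in>large_sizes J p \<epsilon> T. real (alpha c l))
      + real (card (small_jobs J p \<epsilon> T \<inter> early_jobs k \<epsilon> xs)) \<le> real (delta c) * real k"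

text \<open>Large jobs are counted exactly, the two small totals are rounded down to multiples of
  \<open>\<epsilon> * T\<close>, and the early jobs are counted in blocks of \<open>k\<close>. None
  of this raises the load above that of the machine, so the configuration inherits
  feasibility.\<close>

lemma ex_machine_fits:
  fixes p :: "'j \<Rightarrow> real" and T \<epsilon> U :: real and k :: nat
  assumes eps: "\<epsilon> > 0" "1 / \<epsilon> \<in> \<int>" and J: "finite J" "\<forall>j\<in>J. p j \<ge> 0"
    and k: "k > 0" and U: "U \<ge> 0" and T: "T > 0"
    and ord: "size_ordering p A xs" and A: "A \<subseteq> J"
    and load: "machine_load p k U \<epsilon> xs \<le> T"
  shows "\<exists>c. machine_fits J p k U \<epsilon> T xs c"
proof -
  define K where "K = nat \<lfloor>real k / \<epsilon>\<rfloor>"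
  define E where "E = early_jobs k \<epsilon> xs"
  define D where "D = late_jobs k \<epsilon> xs"
  define S where "S = small_jobs J p \<epsilon> T"
  define \<Lambda> where "\<Lambda> = large_sizes J p \<epsilon> T"
  define B where "B = {j \<in> set xs. \<not> p j < \<epsilon> * T}"
  define g where "g = modified_size p k U"
  have xs: "distinct xs" "set xs = A"
    using ord by (auto simp: size_ordering_def)
  have "real k * (1 / \<epsilon>) \<in> \<int>" using eps(2) by (intro Ints_mult) auto
  then have K: "real K = real k / \<epsilon>"
    using eps(1) by (auto simp: K_def elim!: Ints_cases)
  have ED: "E = set (take K xs)" "D = set (drop K xs)"
    by (simp_all add: E_def D_def K_def early_jobs_def late_jobs_def)
  have un: "E \<union> D = set xs" unfolding ED by (metis append_take_drop_id set_append)
  have finE: "finite E" "finite D" by (auto simp: ED)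
  have nonneg: "\<forall>j\<in>A. p j \<ge> 0" using J(2) A by auto
  note small = late_jobs_small[OF eps k U T ord nonneg load, folded D_def]
  \<comment> \<open>Since late jobs are small, all large jobs are early. Hence the small early jobs
    are \<open>E - B\<close> and every late job is a small one.\<close>
  have BE: "B \<subseteq> E" using small un by (auto simp: B_def)
  have SE: "S \<inter> E = E - B"
    using un A xs(2) by (auto simp: S_def small_jobs_def B_def)
  have SD: "S \<inter> D = D"
    using un A xs(2) small by (auto simp: S_def small_jobs_def)
  have Lam: "finite \<Lambda>" "p ` B \<subseteq> \<Lambda>"
    using J(1) A xs(2) by (auto simp: \<Lambda>_def large_sizes_def large_jobs_def B_def)
  have finB: "finite B" by (simp add: B_def)
  define s where "s = sum p (E - B)"
  define t where "t = sum g D"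
  have s0: "s \<ge> 0" unfolding s_def using nonneg xs(2) un by (intro sum_nonneg) auto
  have t0: "t \<ge> 0" unfolding t_def g_def modified_size_def
    using nonneg xs(2) un U by (intro sum_nonneg) (auto intro!: add_nonneg_nonneg)
  have e: "\<epsilon> * T > 0" using eps T by simp
  \<comment> \<open>The least number of blocks of size \<open>k\<close> covering the early jobs. On
    an idle machine it is 0, and the configuration contributes \<open>- U\<close>, in agreement with
    the value -1 of the floor in \<open>machine_load\<close>.\<close>
  define d where "d = nat \<lceil>real (card E) / real k\<rceil>"
  define b where "b = (if D = {} then 0 else 1 :: nat)"
  define c where "c = Config (\<lambda>l. card {j \<in> B. p j = l}) (nat \<lfloor>s / (\<epsilon> * T)\<rfloor>)
    (nat \<lfloor>t / (\<epsilon> * T)\<rfloor>) b d"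
  have bz: "t = 0" if "b = 0" using that by (simp add: b_def t_def split: if_splits)
  have sumE: "sum p E = sum p B + s"
    unfolding s_def using sum.subset_diff[OF BE finE(1), of p] by simp
  have cardE: "card E = card B + card (E - B)"
    using card_Diff_subset[OF finB BE] card_mono[OF finE(1) BE] by simp
  have cE: "card E = min (length xs) K" using xs(1) by (simp add: ED distinct_card)
  have dk: "real (card E) \<le> real d * real k"
  proof -
    have "real (card E) / real k \<le> real d" unfolding d_def by linarith
    then show ?thesis using k by (simp add: pos_divide_le_eq)
  qed
  have d_le: "real d \<le> 1 / \<epsilon>"
  proof -
    have "real (card E) \<le> real k / \<epsilon>" using cE K by linarith
    then have "real (card E) / real k \<le> 1 / \<epsilon>" using k by (simp add: pos_divide_le_eq)
    then have "\<lceil>real (card E) / real k\<rceil> \<le> \<lceil>1 / \<epsilon>\<rceil>" by (rule ceiling_mono)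
    moreover have "of_int \<lceil>1 / \<epsilon>\<rceil> = 1 / \<epsilon>" using eps(2) by (auto elim!: Ints_cases)
    moreover have "real (card E) / real k \<ge> 0" by simp
    then have "\<lceil>real (card E) / real k\<rceil> \<ge> 0" by linarith
    ultimately show ?thesis unfolding d_def by linarith
  qed
  have ld: "machine_load p k U \<epsilon> xs \<ge> sum p E + t + U * (real d - 1 + real b)"
  proof (cases "length xs \<le> K")
    case True
    then have DE: "D = {}" by (simp add: ED)
    have card: "real (card (set xs)) \<le> real k / \<epsilon>" using True xs(1) by (simp add: distinct_card flip: K)
    \<comment> \<open>For n = \<open>card E\<close> this is ceil(n / k) \<le> floor((n - 1) / k) +
      1, which also holds for n = 0.\<close>
    have "real d - 1 \<le> of_int \<lfloor>(real (card E) - 1) / real k\<rfloor>"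
    proof -
      define f where "f = \<lfloor>(real (card E) - 1) / real k\<rfloor>"
      have "(real (card E) - 1) / real k < of_int f + 1" unfolding f_def by linarith
      then have "real (card E) - 1 < (of_int f + 1) * real k"
        using k by (simp add: pos_divide_less_eq)
      \<comment> \<open>Both sides are integers, so the strict inequality sharpens to
        \<open>card E \<le> (f + 1) * k\<close>, which absorbs the -1 under the floor.\<close>
      then have "of_int (int (card E) - 1) < (of_int ((f + 1) * int k) :: real)" by simp
      then have "int (card E) \<le> (f + 1) * int k" by linarith
      then have "real (card E) \<le> (of_int f + 1) * real k"
        by (metis (no_types, opaque_lifting) of_int_1 of_int_add of_int_le_iff of_int_mult of_int_of_nat_eq)
      then have "real (card E) / real k \<le> of_int (f + 1)"
        using k by (simp add: pos_divide_le_eq)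
      then have "\<lceil>real (card E) / real k\<rceil> \<le> f + 1" by (simp add: ceiling_le_iff)
      moreover have "real (card E) / real k \<ge> 0" by simp
      then have "\<lceil>real (card E) / real k\<rceil> \<ge> 0" by linarith
      ultimately show ?thesis unfolding d_def f_def[symmetric] by linarith
    qed
    from mult_left_mono[OF this U] show ?thesis
      using DE card by (simp add: machine_load_def E_def[symmetric] b_def t_def mult.commute)
  next
    case False
    then have "D \<noteq> {}" by (simp add: ED)
    moreover have "\<not> real (card (set xs)) \<le> real k / \<epsilon>"
      using False xs(1) by (simp add: distinct_card flip: K)
    \<comment> \<open>With \<open>b = 1\<close> the term -1 cancels, so the configuration pays
      \<open>U * d\<close>, covered by the flat charge \<open>U / \<epsilon>\<close>.\<close>
    moreover have "U * real d \<le> U / \<epsilon>" using mult_left_mono[OF d_le U] by simp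
    ultimately show ?thesis
      by (simp add: machine_load_def E_def[symmetric] D_def[symmetric] b_def t_def g_def)
  qed
  have "config_load \<Lambda> U \<epsilon> T c \<le> sum p E + t + U * (real d - 1 + real b)"
  proof -
    have "real (nat \<lfloor>t / (\<epsilon> * T)\<rfloor>) * (\<epsilon> * T) * real b \<le> t"
      using floor_nat_div_bounds(1)[OF t0 e] t0 by (auto simp: b_def)
    moreover note floor_nat_div_bounds(1)[OF s0 e] sum_fibre_sizes(1)[OF finB Lam]
    ultimately show ?thesis
      unfolding config_load_def c_def sumE by (simp add: mult_ac)
  qed
  then have "config_load \<Lambda> U \<epsilon> T c \<le> T" using ld load by linarith
  moreover have "is_config \<Lambda> \<epsilon> c"
  proof -
    have "card {j \<in> B. p j = l} = 0" if "l \<notin> \<Lambda>" for l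
      using that Lam(2) finB by auto
    then show ?thesis using d_le bz unfolding is_config_def c_def
      by (auto simp: b_def)
  qed
  ultimately have feas: "c \<in> feasible_configs \<Lambda> U \<epsilon> T" by (simp add: feasible_configs_def)
  have al: "alpha c l = card {j \<in> set xs. \<not> p j < \<epsilon> * T \<and> p j = l}" for l
    unfolding c_def B_def by (simp add: conj_assoc)
  have be: "sum p (S \<inter> E) \<le> (real (beta c) + 1) * \<epsilon> * T"
    using floor_nat_div_bounds(2)[OF s0 e] by (simp add: SE c_def mult.assoc flip: s_def)
  \<comment> \<open>Without late jobs the zero bit makes the right side vanish, but then
    \<open>t = 0\<close> as well.\<close>
  have ga: "sum g (S \<inter> D) \<le> real (gamma_bit c) * (real (gamma c) + 1) * \<epsilon> * T"
    using floor_nat_div_bounds(2)[OF t0 e] bz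
    by (cases "D = {}") (simp_all add: SD c_def mult.assoc b_def flip: t_def)
  have "(\<Sum>l\<in>\<Lambda>. alpha c l) = card B"
    unfolding c_def using sum_fibre_sizes(2)[OF finB Lam] by simp
  then have "(\<Sum>l\<in>\<Lambda>. real (alpha c l)) = real (card B)" by (simp flip: of_nat_sum)
  then have "(\<Sum>l\<in>\<Lambda>. real (alpha c l)) + real (card (S \<inter> E)) \<le> real (delta c) * real k"
    using dk cardE by (simp add: SE c_def)
  with feas al be ga show ?thesis
    unfolding machine_fits_def E_def D_def S_def \<Lambda>_def g_def by blast
qed

section \<open>Assembling the MILP solution from the machines\<close>

text \<open>Exchanging the sums leaves one bounded sum per machine. With \<open>I\<close> the
  machines of one configuration, the bound \<open>b\<close> is common to all of them and
  \<open>card I\<close> becomes the factor \<open>x c\<close>.\<close>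

lemma sum_indicators_le:
  fixes w :: "'j \<Rightarrow> real"
  assumes "finite S" "\<And>i. i \<in> I \<Longrightarrow> (\<Sum>j\<in>S \<inter> E i. w j) \<le> b"
  shows "(\<Sum>j\<in>S. (\<Sum>i\<in>I. of_bool (j \<in> E i)) * w j) \<le> real (card I) * b"
proof -
  have "(\<Sum>j\<in>S. (\<Sum>i\<in>I. of_bool (j \<in> E i)) * w j) = (\<Sum>i\<in>I. \<Sum>j\<in>S. of_bool (j \<in> E i) * w j)"
    unfolding sum_distrib_right by (rule sum.swap)
  also have "\<dots> = (\<Sum>i\<in>I. \<Sum>j\<in>S \<inter> E i. w j)"
    unfolding sum.inter_restrict[OF assms(1)] by (intro sum.cong refl) auto
  also have "\<dots> \<le> real (card I) * b" using assms(2) by (rule sum_bounded_above)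
  finally show ?thesis .
qed

theorem theorem1:
  fixes J :: "'j set" and p :: "'j \<Rightarrow> real" and m k :: nat and U \<epsilon> T :: real
  assumes "\<epsilon> > 0" and "\<epsilon> \<in> \<rat>" and "1 / \<epsilon> \<in> \<int>"
    and "finite J" and "\<forall>j\<in>J. p j \<ge> 0"
    and "k > 0" and "U \<ge> 0" and "U \<in> \<rat>"
    and "T > 0" and "\<forall>j\<in>J. p j \<le> T"
    and "\<exists>\<sigma> ord. sup_solution J m \<sigma> \<and> (\<forall>i<m. size_ordering p (\<sigma> i) (ord i)) \<and>
           makespan p m k U \<epsilon> ord \<le> T"
  shows "\<exists>x y z. milp_solution J p m k U \<epsilon> T x y z"
proof -
  obtain \<sigma> ord where sol: "sup_solution J m \<sigma>"
    and ord: "\<And>i. i < m \<Longrightarrow> size_ordering p (\<sigma> i) (ord i)"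
    and mk: "makespan p m k U \<epsilon> ord \<le> T" using assms(11) by blast
  have disj: "disjoint_family_on \<sigma> {..<m}" and un: "(\<Union>i<m. \<sigma> i) = J"
    using sol by (auto simp: sup_solution_def)
  have "\<exists>c. machine_fits J p k U \<epsilon> T (ord i) c" if i: "i < m" for i
  proof (rule ex_machine_fits[OF assms(1,3,4,5,6,7,9) ord[OF i]])
    show "\<sigma> i \<subseteq> J" using un i by auto
    \<comment> \<open>The maximum is used only in the presence of a machine \<open>i < m\<close>, so
      its value on the empty set never matters.\<close>
    have "machine_load p k U \<epsilon> (ord i) \<le> makespan p m k U \<epsilon> ord"
      unfolding makespan_def using i by (intro Max_ge) auto
    then show "machine_load p k U \<epsilon> (ord i) \<le> T" using mk by simp
  qed
  then obtain cfg where fits: "\<And>i. i < m \<Longrightarrow> machine_fits J p k U \<epsilon> T (ord i) (cfg i)" by metis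
  define S where "S = small_jobs J p \<epsilon> T"
  define \<Lambda> where "\<Lambda> = large_sizes J p \<epsilon> T"
  define C where "C = feasible_configs \<Lambda> U \<epsilon> T"
  define E where "E i = early_jobs k \<epsilon> (ord i)" for i
  define D where "D i = late_jobs k \<epsilon> (ord i)" for i
  define I where "I c = {i \<in> {..<m}. cfg i = c}" for c
  define x where "x c = card (I c)" for c
  \<comment> \<open>Sums over machines make the constraints additive. That the values are at most 1
    follows later from nonnegativity and the total being 1.\<close>
  define y :: "'j \<Rightarrow> config \<Rightarrow> real" where "y j c = (\<Sum>i\<in>I c. of_bool (j \<in> E i))" for j c
  define z :: "'j \<Rightarrow> config \<Rightarrow> real" where "z j c = (\<Sum>i\<in>I c. of_bool (j \<in> D i))" for j c
  have finC: "finite C" unfolding C_def \<Lambda>_def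
    by (rule finite_feasible_configs[OF assms(4,1,9,7)])
  have finS: "finite S" using assms(4) by (simp add: S_def small_jobs_def)
  have cfgC: "cfg ` {..<m} \<subseteq> C"
    using fits by (auto simp: machine_fits_def C_def \<Lambda>_def)
  \<comment> \<open>Each machine has exactly one configuration and it lies in \<open>C\<close>, so
    the sets \<open>I c\<close> partition the machines.\<close>
  have grp: "(\<Sum>c\<in>C. \<Sum>i\<in>I c. h i) = (\<Sum>i<m. h i)" for h :: "nat \<Rightarrow> 'b :: comm_monoid_add"
    unfolding I_def by (rule sum.group[OF _ finC cfgC]) simp
  have split: "of_bool (j \<in> E i) + of_bool (j \<in> D i) = (of_bool (j \<in> \<sigma> i) :: real)"
    if i: "i < m" for i j
  proof -
    have xs: "distinct (ord i)" "set (ord i) = \<sigma> i"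
      using ord[OF i] by (auto simp: size_ordering_def)
    have "E i \<union> D i = \<sigma> i" unfolding E_def D_def early_jobs_def late_jobs_def
      by (metis append_take_drop_id set_append xs(2))
    moreover have "E i \<inter> D i = {}" unfolding E_def D_def early_jobs_def late_jobs_def
      using xs(1) by (rule set_take_disj_set_drop_if_distinct) simp
    ultimately show ?thesis by auto
  qed
  have total: "(\<Sum>c\<in>C. y j c + z j c) = 1" if j: "j \<in> S" for j
  proof -
    obtain i0 where i0: "i0 < m" "j \<in> \<sigma> i0"
      using j un by (auto simp: S_def small_jobs_def)
    then have uniq: "j \<in> \<sigma> i \<longleftrightarrow> i = i0" if "i < m" for i
      using disj that by (auto simp: disjoint_family_on_def)
    have "(\<Sum>c\<in>C. y j c + z j c) = (\<Sum>c\<in>C. \<Sum>i\<in>I c. of_bool (j \<in> E i) + of_bool (j \<in> D i))"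
      by (simp add: y_def z_def sum.distrib)
    also have "\<dots> = (\<Sum>i<m. of_bool (j \<in> E i) + of_bool (j \<in> D i))" by (rule grp)
    also have "\<dots> = (\<Sum>i<m. of_bool (i = i0))"
      by (intro sum.cong refl) (simp add: split uniq)
    also have "\<dots> = 1" using i0(1) by (simp add: of_bool_def)
    finally show ?thesis .
  qed
  have y0: "y j c \<ge> 0" and z0: "z j c \<ge> 0" for j c
    by (auto simp: y_def z_def intro!: sum_nonneg)
  have unit: "y j c \<in> {0..1} \<and> z j c \<in> {0..1}" if "j \<in> S" "c \<in> C" for j c
  proof -
    have "y j c + z j c \<le> (\<Sum>c\<in>C. y j c + z j c)"
      by (rule member_le_sum[OF that(2)]) (use finC y0 z0 in auto)
    then show ?thesis using total[OF that(1)] y0[of j c] z0[of j c] by auto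
  qed
  have count: "(\<Sum>c\<in>C. x c) = m"
    using grp[of "\<lambda>_. 1 :: nat"] by (simp add: x_def)
  have fit: "machine_fits J p k U \<epsilon> T (ord i) c" if "i \<in> I c" for i c
    using that fits by (auto simp: I_def)
  have early: "(\<Sum>j\<in>S. y j c * p j) \<le> real (x c) * (real (beta c) + 1) * \<epsilon> * T" for c
  proof -
    have "(\<Sum>j\<in>S. y j c * p j) \<le> real (x c) * ((real (beta c) + 1) * \<epsilon> * T)"
      unfolding y_def x_def
      by (rule sum_indicators_le[OF finS]) (auto simp: S_def E_def machine_fits_def dest!: fit)
    then show ?thesis by (simp add: mult.assoc)
  qed
  have late: "(\<Sum>j\<in>S. z j c * modified_size p k U j)
      \<le> real (x c) * real (gamma_bit c) * (real (gamma c) + 1) * \<epsilon> * T" for c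
  proof -
    have "(\<Sum>j\<in>S. z j c * modified_size p k U j)
        \<le> real (x c) * (real (gamma_bit c) * (real (gamma c) + 1) * \<epsilon> * T)"
      unfolding z_def x_def
      by (rule sum_indicators_le[OF finS]) (auto simp: S_def D_def machine_fits_def dest!: fit)
    then show ?thesis by (simp add: mult.assoc)
  qed
  have number: "(\<Sum>l\<in>\<Lambda>. real (alpha c l) * real (x c)) + (\<Sum>j\<in>S. y j c)
      \<le> real (x c) * real (delta c) * real k" for c
  proof -
    \<comment> \<open>Unit weights turn the sum into a count of small early jobs. The
      \<open>alpha\<close> total depends only on \<open>c\<close>, so it can be moved into the
      common bound.\<close>
    have "(\<Sum>j\<in>S. y j c * 1)
        \<le> real (x c) * (real (delta c) * real k - (\<Sum>l\<in>\<Lambda>. real (alpha c l)))"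
      unfolding y_def x_def
      by (rule sum_indicators_le[OF finS])
        (auto simp: S_def E_def \<Lambda>_def machine_fits_def dest!: fit)
    then show ?thesis by (simp add: algebra_simps sum_distrib_left)
  qed
  have large: "(\<Sum>c\<in>C. alpha c l * x c) = card (large_jobs_of_size J p \<epsilon> T l)" for l
  proof -
    define B where "B i = {j \<in> \<sigma> i. \<not> p j < \<epsilon> * T \<and> p j = l}" for i
    have aB: "alpha (cfg i) l = card (B i)" if "i < m" for i
      using fits[OF that] ord[OF that] by (simp add: machine_fits_def size_ordering_def B_def)
    \<comment> \<open>Writing \<open>x c\<close> as a sum of ones over \<open>I c\<close> allows
      regrouping by machine; the disjoint sets \<open>B i\<close> then make up all large jobs of
      size \<open>l\<close>.\<close>
    have "(\<Sum>c\<in>C. alpha c l * x c) = (\<Sum>c\<in>C. \<Sum>i\<in>I c. alpha (cfg i) l)"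
      by (intro sum.cong refl) (simp add: x_def I_def)
    also have "\<dots> = (\<Sum>i<m. card (B i))" unfolding grp by (simp add: aB)
    also have "\<dots> = card (\<Union>i<m. B i)"
    proof (rule card_UN_disjoint[symmetric])
      have "\<sigma> i \<subseteq> J" if "i < m" for i using un that by auto
      then show "\<forall>i\<in>{..<m}. finite (B i)"
        using finite_subset[OF _ assms(4)] by (auto simp: B_def)
      show "\<forall>i\<in>{..<m}. \<forall>i'\<in>{..<m}. i \<noteq> i' \<longrightarrow> B i \<inter> B i' = {}"
        using disj by (auto simp: disjoint_family_on_def B_def)
    qed simp
    also have "(\<Union>i<m. B i) = large_jobs_of_size J p \<epsilon> T l"
      using un by (auto simp: B_def large_jobs_of_size_def large_jobs_def)
    finally show ?thesis .
  qed
  have "milp_solution J p m k U \<epsilon> T x y z"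
    unfolding milp_solution_def Let_def S_def[symmetric] \<Lambda>_def[symmetric] C_def[symmetric]
    using unit count total early late large number by blast
  then show ?thesis by blast
qed

end
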